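(* Let $0<q\le\infty$, $0<p\le t<\infty$ and $0<r\le\infty$. Then $M_{p,q}^{t,r}(\mathbb R^n)$ is not trivial (that is, $M_{p,q}^{t,r}(\mathbb R^n)\ne\{0\}$) if and only if $0<p<t<r<\infty$ or $0<p\le t<r=\infty$.
   Context: Functions equal almost everywhere are identified. Lorentz norm: with $d_f(s)=|\{x:|f(x)|>s\}|$ and $f^*(u)=\inf\{s>0:d_f(s)\le u\}$, $\|f\|_{L^{p,q}}=\left(\int_0^\infty(u^{1/p}f^*(u))^q\frac{du}{u}\right)^{1/q}$ for $q<\infty$ and $\|f\|_{L^{p,\infty}}=\sup_{u>0}u^{1/p}f^*(u)$; $\|f\|_{L^{p,q}(Q)}=\|f\chi_Q\|_{L^{p,q}}$. Dyadic cubes: $Q_{j,m}=\prod_{i=1}^n[2^{-j}m_i,2^{-j}(m_i+1))$, $j\in\mathbb Z$, $m\in\mathbb Z^n$; $\mathcal D$ is the set of all of them. $M_{p,q}^{t,r}(\mathbb R^n)$ is the set of measurable $f$ with $\|f\|_{M_{p,q}^{t,r}(\mathbb R^n)}=\left(\sum_{Q\in\mathcal D}|Q|^{r/t-r/p}\|f\|_{L^{p,q}(Q)}^r\right)^{1/r}<\infty$ (supremum over $Q\in\mathcal D$ of $|Q|^{1/t-1/p}\|f\|_{L^{p,q}(Q)}$ if $r=\infty$). *)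

theory Defs
  imports "HOL-Analysis.Analysis"
begin

text \<open>
  Conventions. The underlying space is \<open>real ^ 'n\<close> with the complete Lebesgue measure, and functions
  are complex valued. Quasi-norms take values in \<open>ennreal\<close>, so that they are defined for every
  function. The exponents \<open>p\<close>, \<open>t\<close> are finite, hence real; \<open>q\<close> and \<open>r\<close> may be infinite and are
  of type \<open>ennreal\<close>.
\<close>

text \<open>
  Real power of an extended nonnegative number. It is used only for \<open>a > 0\<close>, where
  \<open>0\<^sup>a = 0\<close> and \<open>\<infinity>\<^sup>a = \<infinity>\<close>.
\<close>

definition epowr :: "ennreal \<Rightarrow> real \<Rightarrow> ennreal" where
  "epowr x a = (if x = \<infinity> then \<infinity> else ennreal (enn2real x powr a))"

definition distr_fun :: "(real ^ 'n \<Rightarrow> complex) \<Rightarrow> real \<Rightarrow> ennreal" where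
  "distr_fun f s = emeasure lebesgue {x. norm (f x) > s}"

text \<open>The infimum is taken in \<open>ennreal\<close>, so it is \<open>\<infinity>\<close> if no \<open>s\<close> qualifies.\<close>

definition rearrangement :: "(real ^ 'n \<Rightarrow> complex) \<Rightarrow> real \<Rightarrow> ennreal" where
  "rearrangement f u = (INF s \<in> {s. s > 0 \<and> distr_fun f s \<le> ennreal u}. ennreal s)"

definition lorentz_norm :: "real \<Rightarrow> ennreal \<Rightarrow> (real ^ 'n \<Rightarrow> complex) \<Rightarrow> ennreal" where
  "lorentz_norm p q f =
     (if q = \<infinity> then (SUP u \<in> {0<..}. ennreal (u powr (1 / p)) * rearrangement f u)
      else epowr
        (\<integral>\<^sup>+ u \<in> {0<..}.
           epowr (ennreal (u powr (1 / p)) * rearrangement f u) (enn2real q) * ennreal (1 / u) \<partial>lborel)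
        (1 / enn2real q))"

definition lorentz_norm_on ::
    "real \<Rightarrow> ennreal \<Rightarrow> (real ^ 'n) set \<Rightarrow> (real ^ 'n \<Rightarrow> complex) \<Rightarrow> ennreal" where
  "lorentz_norm_on p q Q f = lorentz_norm p q (\<lambda>x. f x * indicator Q x)"

definition dyadic_cube :: "int \<Rightarrow> int ^ 'n \<Rightarrow> (real ^ 'n) set" where
  "dyadic_cube j m =
     {x. \<forall>i. 2 powi (-j) * of_int (m $ i) \<le> x $ i \<and> x $ i < 2 powi (-j) * (of_int (m $ i) + 1)}"

definition dyadic_cubes :: "(real ^ 'n) set set" where
  "dyadic_cubes = {dyadic_cube j m | j m. True}"

definition bml_norm ::
    "real \<Rightarrow> ennreal \<Rightarrow> real \<Rightarrow> ennreal \<Rightarrow> (real ^ 'n \<Rightarrow> complex) \<Rightarrow> ennreal" where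
  "bml_norm p q t r f =
     (if r = \<infinity> then
        (SUP Q \<in> dyadic_cubes. ennreal (measure lebesgue Q powr (1 / t - 1 / p)) * lorentz_norm_on p q Q f)
      else epowr
        (\<Sum>\<^sub>\<infinity> Q \<in> dyadic_cubes.
           ennreal (measure lebesgue Q powr (enn2real r / t - enn2real r / p)) *
           epowr (lorentz_norm_on p q Q f) (enn2real r))
        (1 / enn2real r))"

definition ae_eq :: "((real ^ 'n \<Rightarrow> complex) \<times> (real ^ 'n \<Rightarrow> complex)) set" where
  "ae_eq = {(f, g). f \<in> borel_measurable lebesgue \<and> g \<in> borel_measurable lebesgue \<and>
                    (AE x in lebesgue. f x = g x)}"

text \<open>
  The space \<open>M\<^bsub>p,q\<^esub>\<^bsup>t,r\<^esup>\<close> consists of classes modulo almost everywhere equality. The quasi-norm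
  depends only on the class, so each class lies entirely in the set of functions of finite norm.
\<close>

definition bml_space ::
    "real \<Rightarrow> ennreal \<Rightarrow> real \<Rightarrow> ennreal \<Rightarrow> (real ^ 'n \<Rightarrow> complex) set set" where
  "bml_space p q t r = {f \<in> borel_measurable lebesgue. bml_norm p q t r f < \<infinity>} // ae_eq"

definition ae_zero :: "(real ^ 'n \<Rightarrow> complex) set" where
  "ae_zero = ae_eq `` {\<lambda>x. 0}"

end

(* On a set A of finite measure the Lorentz quasi-norm of the indicator is comparable with |A|^(1/p),
   so the Bourgain-Morrey quasi-norm is governed by the sum of |Q|^(r/t - r/p) |E Int Q|^(r/p) over
   the dyadic cubes Q.

   Let E be the unit cube. The 2^(kn) subcubes of side 2^(-k) contribute 2^(-kn(r/t - 1)), and the only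
   ancestor of side 2^k contributes 2^(kn(r/t - r/p)). Both geometric series converge if p < t < r.

   Let conversely f be nonzero on a set of positive measure, and choose s > 0 and a unit cube I in which
   E = {|f| > s} has measure v > 0. If p = t, every dyadic ancestor of I contributes at least a fixed
   amount. If r <= t, every generation of subcubes Q of I does: with d = |E Int Q| / |Q|
   and |Q| <= 1 the term is at least |Q| d^(r/p) >= (v/2)^(r/p) |Q| (d - v/2), and these bounds add
   up to (v/2)^(r/p) v/2. In both cases the sum is infinite. *)

theory Submission
  imports Defs
begin

section \<open>Arithmetic and measure of the dyadic grid\<close>

subsection \<open>Dyadic cubes\<close>

text \<open>Rescaling by 2^j turns the half-open edges into unit intervals with integer ends, so the
  index of the cube is a vector of floors. Uniqueness and nesting of cubes thereby become facts
  about integers.\<close>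

lemma mem_dyadic_cube: "x \<in> dyadic_cube j m \<longleftrightarrow> (\<forall>i. \<lfloor>2 powi j * x $ i\<rfloor> = m $ i)"
proof -
  have "(2 powi (-j) * of_int k \<le> y \<and> y < 2 powi (-j) * (of_int k + 1)) \<longleftrightarrow> \<lfloor>2 powi j * y\<rfloor> = k"
    for y :: real and k :: int
  proof -
    have "2 powi (-j) * of_int k \<le> y \<longleftrightarrow> of_int k \<le> 2 powi j * y"
         "y < 2 powi (-j) * (of_int k + 1) \<longleftrightarrow> 2 powi j * y < of_int k + 1"
      by (auto simp: power_int_minus field_simps)
    then show ?thesis by (simp add: floor_eq_iff)
  qed
  then show ?thesis by (simp add: dyadic_cube_def)
qed

lemma dyadic_cube_eq_if_meet:
  "x \<in> dyadic_cube j m \<Longrightarrow> x \<in> dyadic_cube j m' \<Longrightarrow> m = m'"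
  by (simp add: mem_dyadic_cube vec_eq_iff)

text \<open>Dividing by 2^k commutes with the floor when \<open>div\<close> is used on the integer
  side, since \<open>div\<close> rounds down for negative indices too. The level \<open>i\<close>
  may be negative, so ancestors of unit cubes are covered.\<close>

lemma dyadic_cube_parent:
  assumes "x \<in> dyadic_cube (i + int k) m"
  shows "x \<in> dyadic_cube i (\<chi> l. m $ l div 2 ^ k)"
proof -
  have "\<lfloor>2 powi i * x $ l\<rfloor> = \<lfloor>2 powi (i + int k) * x $ l\<rfloor> div 2 ^ k" for l
  proof -
    have "2 powi i * x $ l = (2 powi (i + int k) * x $ l) / of_int (2 ^ k)"
      by (simp add: power_int_add)
    then show ?thesis using floor_divide_real_eq_div[of "2 ^ k"] by simp
  qed
  with assms show ?thesis by (simp add: mem_dyadic_cube)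
qed

text \<open>These index the descendants, k generations down, of a cube with index m. The level of
  that cube does not enter, so one set serves all scales.\<close>

definition subindices :: "nat \<Rightarrow> int ^ 'n \<Rightarrow> (int ^ 'n) set" where
  "subindices k m = {m'. \<forall>l. m' $ l div 2 ^ k = m $ l}"

text \<open>Each coordinate is confined to an interval of 2^k integers. The exact cardinality is not
  computed here; it follows later from a comparison of volumes.\<close>

lemma finite_subindices: "finite (subindices k m)"
proof -
  have bounds: "2 ^ k * (y div 2 ^ k) \<le> y" "y < 2 ^ k * (y div 2 ^ k + 1)" for y :: int
  proof -
    have "0 \<le> y mod 2 ^ k" "y mod 2 ^ k < 2 ^ k" by simp_all
    moreover have "2 ^ k * (y div 2 ^ k) + y mod 2 ^ k = y" by (rule mult_div_mod_eq)
    ultimately show "2 ^ k * (y div 2 ^ k) \<le> y" "y < 2 ^ k * (y div 2 ^ k + 1)"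
      unfolding distrib_left mult_1_right by linarith+
  qed
  have "vec_nth ` subindices k m \<subseteq> (\<Pi>\<^sub>E l\<in>UNIV. {2 ^ k * m $ l..<2 ^ k * (m $ l + 1)})"
    unfolding PiE_UNIV_domain
  proof (intro image_subsetI Pi_I)
    fix m' l assume "m' \<in> subindices k m"
    then have "m' $ l div 2 ^ k = m $ l" by (simp add: subindices_def)
    with bounds[of "m' $ l"] show "m' $ l \<in> {2 ^ k * m $ l..<2 ^ k * (m $ l + 1)}" by simp
  qed
  moreover have "finite (\<Pi>\<^sub>E l\<in>UNIV. {2 ^ k * m $ l..<2 ^ k * (m $ l + 1)})"
    by (intro finite_PiE) auto
  ultimately have "finite (vec_nth ` subindices k m)" by (rule finite_subset)
  then show ?thesis by (rule finite_imageD) (simp add: inj_on_def vec_nth_inject)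
qed

text \<open>Every point lies in some cube of the finer level, and the coarser cube that contains
  this one also contains the point. Uniqueness of the index at a fixed level then identifies the
  coarser cube.\<close>

lemma dyadic_cube_partition:
  "dyadic_cube i m = (\<Union>m'\<in>subindices k m. dyadic_cube (i + int k) m')"
proof (intro set_eqI iffI)
  fix x assume x: "x \<in> dyadic_cube i m"
  define m' where "m' = (\<chi> l. \<lfloor>2 powi (i + int k) * x $ l\<rfloor>)"
  have m': "x \<in> dyadic_cube (i + int k) m'" by (simp add: mem_dyadic_cube m'_def)
  with dyadic_cube_parent x dyadic_cube_eq_if_meet have "(\<chi> l. m' $ l div 2 ^ k) = m" by blast
  then have "m' \<in> subindices k m" by (auto simp: subindices_def)
  with m' show "x \<in> (\<Union>m'\<in>subindices k m. dyadic_cube (i + int k) m')" by blast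
next
  fix x assume "x \<in> (\<Union>m'\<in>subindices k m. dyadic_cube (i + int k) m')"
  then obtain m' where m': "m' \<in> subindices k m" "x \<in> dyadic_cube (i + int k) m'" by blast
  then have "(\<chi> l. m' $ l div 2 ^ k) = m" by (simp add: subindices_def vec_eq_iff)
  with m' dyadic_cube_parent show "x \<in> dyadic_cube i m" by blast
qed

lemma disjoint_dyadic_cubes: "disjoint_family_on (dyadic_cube j) A"
  unfolding disjoint_family_on_def using dyadic_cube_eq_if_meet by blast

lemma dyadic_cube_borel [measurable]: "dyadic_cube j m \<in> sets borel"
  unfolding dyadic_cube_def by measurable

text \<open>The half-open cube is squeezed between an open and a closed box of equal volume.\<close>

lemma emeasure_dyadic_cube:
  fixes m :: "int ^ 'n"
  shows "emeasure lborel (dyadic_cube j m) = ennreal (2 powr (- real_of_int j * CARD('n)))"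
proof -
  define a b :: "real ^ 'n" where "a = (\<chi> i. 2 powi (-j) * of_int (m $ i))"
    and "b = (\<chi> i. 2 powi (-j) * (of_int (m $ i) + 1))"
  have ab: "box a b \<subseteq> dyadic_cube j m" "dyadic_cube j m \<subseteq> cbox a b"
    by (auto simp: a_def b_def dyadic_cube_def mem_box_cart less_imp_le)
  have le: "a \<bullet> i \<le> b \<bullet> i" if "i \<in> Basis" for i
    using that by (auto simp: Basis_vec_def a_def b_def inner_axis)
  have "(\<Prod>i\<in>Basis. (b - a) \<bullet> i) = measure lborel (cbox a b)"
    using le by (simp add: inner_diff_left)
  also have "\<dots> = (\<Prod>i\<in>UNIV. b $ i - a $ i)"
    using le by (intro content_cbox_cart) (auto simp: box_ne_empty)
  also have "\<dots> = (2 powr - real_of_int j) ^ CARD('n)"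
    by (simp add: a_def b_def algebra_simps power_int_minus powr_minus powr_real_of_int' power_inverse)
  also have "\<dots> = 2 powr (- real_of_int j * CARD('n))"
    by (simp add: powr_powr flip: powr_realpow)
  finally have vol: "(\<Prod>i\<in>Basis. (b - a) \<bullet> i) = 2 powr (- real_of_int j * CARD('n))" .
  show ?thesis
    using emeasure_mono[OF ab(1), of lborel] emeasure_mono[OF ab(2), of lborel] le vol
    by (simp add: emeasure_lborel_box_eq emeasure_lborel_cbox_eq)
qed

lemma dyadic_cube_lmeasurable [simp]: "dyadic_cube j m \<in> lmeasurable"
  using emeasure_dyadic_cube[of j m] by (intro fmeasurableI) auto

lemma measure_dyadic_cube:
  "measure lebesgue (dyadic_cube j m :: (real ^ 'n) set) = 2 powr (- real_of_int j * CARD('n))"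
  using emeasure_dyadic_cube by (simp add: measure_def)

text \<open>The volume determines the level, and a common point then determines the index. This
  allows sums over sets of cubes to be reindexed by their indices.\<close>

lemma dyadic_cube_eq_iff [simp]: "dyadic_cube i m = dyadic_cube j m' \<longleftrightarrow> i = j \<and> m = m'"
proof
  assume eq: "dyadic_cube i m = dyadic_cube j m'"
  then have "i = j"
    using measure_dyadic_cube[of i m] measure_dyadic_cube[of j m'] by (simp add: powr_inj)
  moreover have "m = m'"
  proof -
    \<comment> \<open>The lower corner, which belongs to the half-open cube, witnesses that the cube
      is not empty.\<close>
    have "(\<chi> l. 2 powi (-i) * of_int (m $ l)) \<in> dyadic_cube i m"
      by (simp add: mem_dyadic_cube power_int_minus flip: mult.assoc)
    with eq \<open>i = j\<close> show ?thesis by (metis dyadic_cube_eq_if_meet)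
  qed
  ultimately show "i = j \<and> m = m'" by simp
qed simp

text \<open>This is finite additivity over one generation. It is applied to a level set, to
  distribute its mass, and to the whole space, to count subcubes.\<close>

lemma measure_dyadic_cube_partition:
  assumes "A \<in> sets lebesgue"
  shows "(\<Sum>m'\<in>subindices k m. measure lebesgue (A \<inter> dyadic_cube (i + int k) m'))
    = measure lebesgue (A \<inter> dyadic_cube i m)"
proof -
  have fin: "A \<inter> dyadic_cube (i + int k) m' \<in> lmeasurable" for m'
    using assms fmeasurable_Int_fmeasurable[OF dyadic_cube_lmeasurable assms] by (simp add: Int_commute)
  have "measure lebesgue (\<Union>m'\<in>subindices k m. A \<inter> dyadic_cube (i + int k) m')
     = (\<Sum>m'\<in>subindices k m. measure lebesgue (A \<inter> dyadic_cube (i + int k) m'))"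
  proof (rule measure_finite_Union[OF finite_subindices])
    show "disjoint_family_on (\<lambda>m'. A \<inter> dyadic_cube (i + int k) m') (subindices k m)"
      using disjoint_dyadic_cubes[of "i + int k"] unfolding disjoint_family_on_def by blast
  qed (use fin fmeasurableD2[OF fin] in \<open>auto simp del: emeasure_completion\<close>)
  then show ?thesis by (simp add: dyadic_cube_partition[of i m k])
qed

lemma measure_unit_cube [simp]: "measure lebesgue (dyadic_cube 0 m) = 1"
  by (simp add: measure_dyadic_cube)

section \<open>Comparison of Lorentz quasi-norms with powers of the measure\<close>

subsection \<open>Lorentz quasi-norms\<close>

lemma epowr_ennreal: "0 \<le> y \<Longrightarrow> epowr (ennreal y) a = ennreal (y powr a)"
  by (simp add: epowr_def)

lemma epowr_mono: "x \<le> y \<Longrightarrow> 0 \<le> a \<Longrightarrow> epowr x a \<le> epowr y a"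
  by (auto simp: epowr_def top_unique enn2real_mono less_top intro!: ennreal_leI powr_mono2)

lemma epowr_less_top_iff [simp]: "epowr x a < top \<longleftrightarrow> x < top"
  by (auto simp: epowr_def less_top)

text \<open>The rearrangement of \<open>indicator A\<close> is at most 1 below |A| and 0 from there
  on, so only the weight on (0, |A|) has to be integrated or maximised. The constant is fixed before
  A and depends on p and q only.\<close>

lemma lorentz_indicator_le:
  fixes A :: "(real ^ 'n) set"
  assumes "0 < p" "0 < q"
  obtains C where "0 \<le> C" "\<And>A :: (real ^ 'n) set. A \<in> lmeasurable \<Longrightarrow>
    lorentz_norm p q (indicator A) \<le> ennreal (C * measure lebesgue A powr (1 / p))"
proof -
  have re: "rearrangement (indicator A :: real ^ 'n \<Rightarrow> complex) u
      \<le> indicator {..<measure lebesgue A} u" if A: "A \<in> lmeasurable" and "u > 0"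
    for A :: "(real ^ 'n) set" and u
  proof (cases "u < measure lebesgue A")
    case True
    \<comment> \<open>The level 1 is admissible because the level set is strict: the indicator
      nowhere exceeds 1.\<close>
    have "rearrangement (indicator A :: real ^ 'n \<Rightarrow> complex) u \<le> ennreal 1"
      unfolding rearrangement_def by (intro INF_lower) (auto simp: distr_fun_def indicator_def)
    with True show ?thesis by simp
  next
    case False
    have "distr_fun (indicator A :: real ^ 'n \<Rightarrow> complex) s \<le> ennreal u" if "s > 0" for s
    proof -
      have "distr_fun (indicator A :: real ^ 'n \<Rightarrow> complex) s \<le> emeasure lebesgue A"
        unfolding distr_fun_def using that A by (intro emeasure_mono) (auto simp: indicator_def fmeasurableD)
      also have "\<dots> \<le> ennreal u" using False A by (simp add: emeasure_eq_measure2 ennreal_leI)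
      finally show ?thesis .
    qed
    then have "rearrangement (indicator A :: real ^ 'n \<Rightarrow> complex) u \<le> ennreal s" if "s > 0" for s
      unfolding rearrangement_def using that by (intro INF_lower) auto
    \<comment> \<open>All positive levels are admissible, but 0 is excluded from the infimum, so the
      bound 0 is reached only in the limit.\<close>
    then have "rearrangement (indicator A :: real ^ 'n \<Rightarrow> complex) u \<le> 0"
      by (metis add_0 ennreal_le_epsilon)
    then show ?thesis by simp
  qed
  show thesis
  proof (cases "q = \<infinity>")
    case True
    have "lorentz_norm p q (indicator A :: real ^ 'n \<Rightarrow> complex)
        \<le> ennreal (1 * measure lebesgue A powr (1 / p))" if A: "A \<in> lmeasurable" for A
      unfolding lorentz_norm_def if_P[OF True]
    proof (intro SUP_least)
      fix u :: real assume u: "u \<in> {0<..}"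
      have "ennreal (u powr (1 / p)) * rearrangement (indicator A :: real ^ 'n \<Rightarrow> complex) u
         \<le> ennreal (u powr (1 / p)) * indicator {..<measure lebesgue A} u"
        using re[OF A] u by (intro mult_left_mono) auto
      also have "\<dots> \<le> ennreal (1 * measure lebesgue A powr (1 / p))"
        using u \<open>0 < p\<close> by (auto simp: indicator_def intro!: powr_mono2 ennreal_leI)
      finally show "ennreal (u powr (1 / p)) * rearrangement (indicator A :: real ^ 'n \<Rightarrow> complex) u \<le> \<dots>" .
    qed
    then show thesis using that[of 1] by simp
  next
    case False
    define b where "b = enn2real q"
    have b: "b > 0" using False \<open>0 < q\<close> by (simp add: b_def enn2real_positive_iff less_top)
    have "lorentz_norm p q (indicator A :: real ^ 'n \<Rightarrow> complex)
        \<le> ennreal ((p / b) powr (1 / b) * measure lebesgue A powr (1 / p))" if A: "A \<in> lmeasurable" for A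
    proof -
      let ?v = "measure lebesgue A"
      have "(\<integral>\<^sup>+ u \<in> {0<..}. epowr (ennreal (u powr (1 / p)) * rearrangement (indicator A :: real ^ 'n \<Rightarrow> complex) u) b
           * ennreal (1 / u) \<partial>lborel)
        \<le> (\<integral>\<^sup>+ u. ennreal (u powr (b / p - 1)) * indicator {0..?v} u \<partial>lborel)"
      proof (intro nn_integral_mono)
        fix u :: real
        show "epowr (ennreal (u powr (1 / p)) * rearrangement (indicator A :: real ^ 'n \<Rightarrow> complex) u) b
             * ennreal (1 / u) * indicator {0<..} u \<le> ennreal (u powr (b / p - 1)) * indicator {0..?v} u"
        proof (cases "u > 0")
          case True
          have "epowr (ennreal (u powr (1 / p)) * rearrangement (indicator A :: real ^ 'n \<Rightarrow> complex) u) b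
            \<le> epowr (ennreal (u powr (1 / p)) * indicator {..<?v} u) b"
            using re[OF A] True b by (intro epowr_mono mult_left_mono) auto
          also have "\<dots> = ennreal (u powr (b / p)) * indicator {..<?v} u"
            using b by (auto simp: indicator_def epowr_ennreal powr_powr epowr_def)
          also have "\<dots> * ennreal (1 / u) \<le> ennreal (u powr (b / p - 1)) * indicator {0..?v} u"
            using True by (auto simp: indicator_def powr_diff simp flip: ennreal_mult')
          finally show ?thesis using True by (simp add: mult_right_mono)
        qed simp
      qed
      \<comment> \<open>The power is integrable at 0 because \<open>b / p - 1\<close> exceeds
        -1.\<close>
      also have "\<dots> = ennreal (?v powr (b / p - 1 + 1) / (b / p - 1 + 1))"
        using b \<open>0 < p\<close> by (intro nn_integral_has_integral_lebesgue' has_integral_powr_from_0) auto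
      finally have "lorentz_norm p q (indicator A :: real ^ 'n \<Rightarrow> complex) \<le> epowr (ennreal (?v powr (b / p) / (b / p))) (1 / b)"
        unfolding lorentz_norm_def b_def[symmetric] using False b by (simp add: epowr_mono)
      also have "\<dots> = ennreal ((p / b) powr (1 / b) * ?v powr (1 / p))"
        using b \<open>0 < p\<close> by (simp add: epowr_ennreal powr_mult powr_powr powr_divide)
      finally show ?thesis .
    qed
    then show thesis using that[of "(p / b) powr (1 / b)"] by simp
  qed
qed

text \<open>For u < |A| no level below s is admissible, since its level set contains A and has
  measure greater than u. Hence the rearrangement is at least s there, and it suffices to look at u
  near |A|: the point |A|/2 if q is infinite, the interval (|A|/2, |A|) otherwise.\<close>

lemma lorentz_ge:
  assumes "0 < p" "0 < q"
  obtains c where "0 < c" "\<And>(f :: real ^ 'n \<Rightarrow> complex) A s. f \<in> borel_measurable lebesgue \<Longrightarrow>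
    A \<in> lmeasurable \<Longrightarrow> 0 < s \<Longrightarrow> (\<And>x. x \<in> A \<Longrightarrow> s < norm (f x)) \<Longrightarrow>
    ennreal (c * s * measure lebesgue A powr (1 / p)) \<le> lorentz_norm p q f"
proof -
  have re: "ennreal s \<le> rearrangement f u" if f: "f \<in> borel_measurable lebesgue" and
    A: "A \<in> lmeasurable" and gt: "\<And>x. x \<in> A \<Longrightarrow> s < norm (f x)" and u: "0 < u" "u < measure lebesgue A"
    for f :: "real ^ 'n \<Rightarrow> complex" and A s u
    unfolding rearrangement_def
  proof (intro INF_greatest ennreal_leI)
    have level: "{x. norm (f x) > s'} \<in> sets lebesgue" for s'
    proof -
      note [measurable] = f
      have "{x \<in> space lebesgue. norm (f x) > s'} \<in> sets lebesgue" by measurable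
      then show ?thesis by simp
    qed
    fix s' assume s': "s' \<in> {s. s > 0 \<and> distr_fun f s \<le> ennreal u}"
    show "s \<le> s'"
    proof (rule ccontr)
      assume "\<not> s \<le> s'"
      then have "emeasure lebesgue A \<le> distr_fun f s'"
        unfolding distr_fun_def using gt
        by (intro emeasure_mono level subsetI CollectI) (meson not_le le_less_trans less_imp_le)
      also have "\<dots> \<le> ennreal u" using s' by simp
      finally show False using u A by (simp add: emeasure_eq_measure2)
    qed
  qed
  show thesis
  proof (cases "q = \<infinity>")
    case True
    have "ennreal ((1/2) powr (1 / p) * s * measure lebesgue A powr (1 / p)) \<le> lorentz_norm p q f"
      if f: "f \<in> borel_measurable lebesgue" and
      A: "A \<in> lmeasurable" and gt: "\<And>x. x \<in> A \<Longrightarrow> s < norm (f x)" and s: "0 < s"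
      for f :: "real ^ 'n \<Rightarrow> complex" and A s
    proof (cases "measure lebesgue A > 0")
      case v: True
      let ?u = "measure lebesgue A / 2"
      have "ennreal ((1/2) powr (1 / p) * s * measure lebesgue A powr (1 / p)) = ennreal (?u powr (1 / p)) * ennreal s"
        using s by (simp add: powr_mult powr_divide field_simps flip: ennreal_mult)
      also have "\<dots> \<le> ennreal (?u powr (1 / p)) * rearrangement f ?u"
        using v by (intro mult_left_mono re[OF f A gt]) auto
      also have "\<dots> \<le> lorentz_norm p q f"
        unfolding lorentz_norm_def if_P[OF True] using v by (intro SUP_upper) auto
      finally show ?thesis .
    qed (simp add: zero_less_measure_iff)
    then show thesis using that[of "(1/2) powr (1 / p)"] by simp
  next
    case False
    define b where "b = enn2real q"
    have b: "b > 0" using False \<open>0 < q\<close> by (simp add: b_def enn2real_positive_iff less_top)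
    \<comment> \<open>The first factor comes from bounding u below by |A|/2 in the weight, the
      second from an interval of length |A|/2 on which 1/u is at least 1/|A|.\<close>
    define c where "c = (1/2) powr (1 / p) * (1/2) powr (1 / b)"
    have "ennreal (c * s * measure lebesgue A powr (1 / p)) \<le> lorentz_norm p q f"
      if f: "f \<in> borel_measurable lebesgue" and
      A: "A \<in> lmeasurable" and gt: "\<And>x. x \<in> A \<Longrightarrow> s < norm (f x)" and s: "0 < s"
      for f :: "real ^ 'n \<Rightarrow> complex" and A s
    proof (cases "measure lebesgue A > 0")
      case v: True
      let ?v = "measure lebesgue A"
      \<comment> \<open>A lower bound for the integrand on the upper half of (0, |A|): the power is
        taken at the left end and 1/u at the right end.\<close>
      let ?w = "((?v / 2) powr (1 / p) * s) powr b / ?v"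
      have "ennreal (?w * (?v / 2)) = (\<integral>\<^sup>+ u. ennreal ?w * indicator {?v/2<..<?v} u \<partial>lborel)"
        using v by (simp add: nn_integral_cmult_indicator flip: ennreal_mult)
      also have "\<dots> \<le> (\<integral>\<^sup>+ u \<in> {0<..}. epowr (ennreal (u powr (1 / p)) * rearrangement f u) b
           * ennreal (1 / u) \<partial>lborel)"
      proof (intro nn_integral_mono)
        fix u :: real
        show "ennreal ?w * indicator {?v/2<..<?v} u \<le>
          epowr (ennreal (u powr (1 / p)) * rearrangement f u) b * ennreal (1 / u) * indicator {0<..} u"
        proof (cases "?v/2 < u \<and> u < ?v")
          case True
          then have u: "u > 0" using v by simp
          have "ennreal ?w = ennreal (((?v / 2) powr (1 / p) * s) powr b) * ennreal (1 / ?v)"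
            using v by (simp flip: ennreal_mult)
          also have "\<dots> \<le> ennreal ((u powr (1 / p) * s) powr b) * ennreal (1 / u)"
            using True u v s b \<open>0 < p\<close>
            by (intro mult_mono ennreal_leI powr_mono2 mult_right_mono divide_left_mono) auto
          also have "\<dots> = epowr (ennreal (u powr (1 / p)) * ennreal s) b * ennreal (1 / u)"
            using s by (simp add: epowr_ennreal flip: ennreal_mult)
          also have "\<dots> \<le> epowr (ennreal (u powr (1 / p)) * rearrangement f u) b * ennreal (1 / u)"
            using True b u by (intro mult_right_mono epowr_mono mult_left_mono re[OF f A gt]) auto
          finally show ?thesis using u by (simp add: indicator_def)
        qed simp
      qed
      finally have "epowr (ennreal (?w * (?v / 2))) (1 / b) \<le> lorentz_norm p q f"
        unfolding lorentz_norm_def b_def[symmetric] using False b by (simp add: epowr_mono)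
      also have "?w * (?v / 2) = ((?v / 2) powr (1 / p) * s) powr b * (1/2)"
        using v by simp
      also have "epowr (ennreal \<dots>) (1 / b) = ennreal (c * s * measure lebesgue A powr (1 / p))"
        using b s v by (simp add: epowr_ennreal powr_mult powr_powr powr_divide c_def)
      finally show ?thesis .
    qed (simp add: zero_less_measure_iff)
    then show thesis using that[of c] by (simp add: c_def)
  qed
qed

section \<open>Outside the range, every nonzero function has infinite quasi-norm\<close>

subsection \<open>Divergence\<close>

lemma exists_cube_level_set:
  fixes f :: "real ^ 'n \<Rightarrow> complex"
  assumes f: "f \<in> borel_measurable lebesgue" and nz: "\<not> (AE x in lebesgue. f x = 0)"
  obtains s m where "0 < s" "{x. s < norm (f x)} \<in> sets lebesgue"
    "0 < measure lebesgue ({x. s < norm (f x)} \<inter> dyadic_cube 0 m)"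
proof -
  have level: "{x. s < norm (f x)} \<in> sets lebesgue" for s
  proof -
    note [measurable] = f
    have "{x \<in> space lebesgue. s < norm (f x)} \<in> sets lebesgue" by measurable
    then show ?thesis by simp
  qed
  \<comment> \<open>Pairing a threshold with a unit cube gives a countable family of sets of finite
    measure that covers the set where f is nonzero. Not all of them can be null.\<close>
  define N where "N = (\<lambda>(k, m). {x. 1 / real (Suc k) < norm (f x)} \<inter> dyadic_cube 0 m)"
  have N: "N i \<in> lmeasurable" for i
    using fmeasurable_Int_fmeasurable[OF dyadic_cube_lmeasurable level]
    by (auto simp: N_def Int_commute split: prod.split)
  have "\<exists>i. 0 < measure lebesgue (N i)"
  proof (rule ccontr)
    assume "\<nexists>i. 0 < measure lebesgue (N i)"
    then have "N i \<in> null_sets lebesgue" for i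
      using N[of i] by (intro null_setsI)
        (auto simp: emeasure_eq_measure2 zero_less_measure_iff fmeasurableD simp del: split_paired_All split_paired_Ex)
    then have null: "(\<Union>i. N i) \<in> null_sets lebesgue" by (rule null_sets_UN)
    have "{x \<in> space lebesgue. f x \<noteq> 0} \<subseteq> (\<Union>i. N i)"
    proof
      fix x assume "x \<in> {x \<in> space lebesgue. f x \<noteq> 0}"
      then obtain k where "1 / real (Suc k) < norm (f x)"
        using nat_approx_posE[of "norm (f x)"] by auto
      moreover have "x \<in> dyadic_cube 0 (\<chi> i. \<lfloor>x $ i\<rfloor>)" by (simp add: mem_dyadic_cube)
      ultimately have "x \<in> N (k, \<chi> i. \<lfloor>x $ i\<rfloor>)" by (simp add: N_def)
      then show "x \<in> (\<Union>i. N i)" by blast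
    qed
    with null have "AE x in lebesgue. f x = 0" by (intro AE_I'[of "\<Union>i. N i"]) auto
    with nz show False by simp
  qed
  then obtain k m where "0 < measure lebesgue (N (k, m))" by auto
  with level that[of "1 / real (Suc k)" m] show thesis by (simp add: N_def)
qed

text \<open>The union of the first N levels is a finite set whose sum is at least N c, and finite
  sums bound the infinite one from below. The levels will be either single ancestors or whole
  generations of subcubes.\<close>

lemma infsum_eq_top_if_levels:
  fixes g :: "'a \<Rightarrow> ennreal" and L :: "nat \<Rightarrow> 'a set"
  assumes "0 < c" and fin: "\<And>k. finite (L k)" and sub: "\<And>k. L k \<subseteq> A" and dis: "disjoint_family L"
    and ge: "\<And>k. ennreal c \<le> sum g (L k)"
  shows "infsum g A = \<infinity>"
proof (rule ccontr)
  have ge': "ennreal (real N * c) \<le> infsum g A" for N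
  proof -
    have "ennreal (real N * c) = (\<Sum>k<N. ennreal c)"
      using \<open>0 < c\<close> by (simp add: ennreal_mult ennreal_of_nat_eq_real_of_nat)
    also have "\<dots> \<le> (\<Sum>k<N. sum g (L k))" using ge by (intro sum_mono)
    also have "\<dots> = sum g (\<Union>k<N. L k)"
      using fin dis by (intro sum.UNION_disjoint[symmetric]) (auto simp: disjoint_family_on_def)
    also have "\<dots> \<le> (SUP F\<in>{F. finite F \<and> F \<subseteq> A}. sum g F)"
      using fin sub by (intro SUP_upper) auto
    finally show ?thesis by (simp add: nonneg_infsum_complete)
  qed
  assume "infsum g A \<noteq> \<infinity>"
  then obtain b where b: "0 \<le> b" "infsum g A = ennreal b" by (cases "infsum g A") auto
  obtain N where "b < real N * c" using reals_Archimedean3[OF \<open>0 < c\<close>] by blast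
  with ge'[of N] b show False by (simp add: ennreal_le_iff)
qed

text \<open>The lower Lorentz bound is applied to the part of the level set inside the cube. It
  matters that K is the same for all cubes: it is a power of c s.\<close>

lemma bml_term_ge:
  fixes f :: "real ^ 'n \<Rightarrow> complex"
  assumes "0 < p" "0 < q" "0 < \<rho>" and f: "f \<in> borel_measurable lebesgue"
    and s: "0 < s" and E: "{x. s < norm (f x)} \<in> sets lebesgue"
  obtains K where "0 < K" "\<And>j m. ennreal (K * (measure lebesgue (dyadic_cube j m) powr (\<rho> / t - \<rho> / p) *
      measure lebesgue ({x. s < norm (f x)} \<inter> dyadic_cube j m) powr (\<rho> / p)))
    \<le> ennreal (measure lebesgue (dyadic_cube j m) powr (\<rho> / t - \<rho> / p)) *
       epowr (lorentz_norm_on p q (dyadic_cube j m) f) \<rho>"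
proof -
  from lorentz_ge[OF \<open>0 < p\<close> \<open>0 < q\<close>] obtain c where c: "0 < c"
    "\<And>(f :: real ^ 'n \<Rightarrow> complex) A s. f \<in> borel_measurable lebesgue \<Longrightarrow>
    A \<in> lmeasurable \<Longrightarrow> 0 < s \<Longrightarrow> (\<And>x. x \<in> A \<Longrightarrow> s < norm (f x)) \<Longrightarrow>
    ennreal (c * s * measure lebesgue A powr (1 / p)) \<le> lorentz_norm p q f" by metis
  show thesis
  proof (rule that[of "(c * s) powr \<rho>"])
    show "0 < (c * s) powr \<rho>" using c s by simp
    fix j and m :: "int ^ 'n"
    let ?Q = "dyadic_cube j m" and ?A = "{x. s < norm (f x)} \<inter> dyadic_cube j m"
    have A: "?A \<in> lmeasurable"
      using fmeasurable_Int_fmeasurable[OF dyadic_cube_lmeasurable E] by (simp add: Int_commute)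
    have Q: "?Q \<in> sets lebesgue" by (simp add: fmeasurableD)
    have meas: "(\<lambda>x. f x * indicator ?Q x) \<in> borel_measurable lebesgue"
      using f Q by (intro borel_measurable_times borel_measurable_indicator)
    have "ennreal (c * s * measure lebesgue ?A powr (1 / p)) \<le> lorentz_norm_on p q ?Q f"
      unfolding lorentz_norm_on_def by (rule c(2)[OF meas A s]) auto
    then have "epowr (ennreal (c * s * measure lebesgue ?A powr (1 / p))) \<rho> \<le> epowr (lorentz_norm_on p q ?Q f) \<rho>"
      using \<open>0 < \<rho>\<close> by (intro epowr_mono) auto
    then have "ennreal (measure lebesgue ?Q powr (\<rho> / t - \<rho> / p)) * epowr (ennreal (c * s * measure lebesgue ?A powr (1 / p))) \<rho>
      \<le> ennreal (measure lebesgue ?Q powr (\<rho> / t - \<rho> / p)) * epowr (lorentz_norm_on p q ?Q f) \<rho>"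
      by (intro mult_left_mono) auto
    then show "ennreal ((c * s) powr \<rho> * (measure lebesgue ?Q powr (\<rho> / t - \<rho> / p) * measure lebesgue ?A powr (\<rho> / p)))
      \<le> ennreal (measure lebesgue ?Q powr (\<rho> / t - \<rho> / p)) * epowr (lorentz_norm_on p q ?Q f) \<rho>"
      using c s by (simp add: epowr_ennreal powr_mult powr_powr mult_ac flip: ennreal_mult)
  qed
qed

lemma bml_norm_eq_top:
  fixes f :: "real ^ 'n \<Rightarrow> complex"
  assumes "0 < p" "0 < q" "p \<le> t" "0 < r" "r < \<infinity>" and pr: "p = t \<or> r \<le> ennreal t"
    and f: "f \<in> borel_measurable lebesgue" and nz: "\<not> (AE x in lebesgue. f x = 0)"
  shows "bml_norm p q t r f = \<infinity>"
proof -
  define \<rho> where "\<rho> = enn2real r"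
  have r: "0 < \<rho>" "r = ennreal \<rho>" using \<open>0 < r\<close> \<open>r < \<infinity>\<close>
    by (auto simp: \<rho>_def enn2real_positive_iff less_top)
  obtain s m where s: "0 < s" and E: "{x. s < norm (f x)} \<in> sets lebesgue" and
    pos: "0 < measure lebesgue ({x. s < norm (f x)} \<inter> dyadic_cube 0 m)"
    using exists_cube_level_set[OF f nz] by blast
  define E where "E = {x. s < norm (f x)}"
  have E: "E \<in> sets lebesgue" and pos: "0 < measure lebesgue (E \<inter> dyadic_cube 0 m)"
    using E pos by (simp_all add: E_def)
  define g where "g Q = ennreal (measure lebesgue Q powr (\<rho> / t - \<rho> / p)) *
       epowr (lorentz_norm_on p q Q f) \<rho>" for Q
  obtain K where K: "0 < K" and gK: "\<And>j m. ennreal (K * (measure lebesgue (dyadic_cube j m) powr (\<rho> / t - \<rho> / p) *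
      measure lebesgue (E \<inter> dyadic_cube j m) powr (\<rho> / p))) \<le> g (dyadic_cube j m)"
    using bml_term_ge[OF \<open>0 < p\<close> \<open>0 < q\<close> \<open>0 < \<rho>\<close> f s] E unfolding E_def g_def by metis
  define v where "v = measure lebesgue (E \<inter> dyadic_cube 0 m)"
  have lm: "E \<inter> dyadic_cube j m \<in> lmeasurable" for j m
    using fmeasurable_Int_fmeasurable[OF dyadic_cube_lmeasurable E] by (simp add: Int_commute)
  have "infsum g dyadic_cubes = \<infinity>"
    using pr
  proof
    assume "p = t"
    \<comment> \<open>The ancestor of side 2^k of the chosen unit cube. Since p = t its weight is 1,
      and it contains at least the mass v.\<close>
    define Q where "Q k = dyadic_cube (- int k) (\<chi> l. m $ l div 2 ^ k)" for k
    have sub: "dyadic_cube 0 m \<subseteq> Q k" for k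
      unfolding Q_def using dyadic_cube_parent[of _ "- int k" k m] by auto
    show ?thesis
    proof (rule infsum_eq_top_if_levels[where L = "\<lambda>k. {Q k}" and c = "K * v powr (\<rho> / p)"])
      show "0 < K * v powr (\<rho> / p)" using K pos by (simp add: v_def)
      show "{Q k} \<subseteq> dyadic_cubes" for k by (auto simp: Q_def dyadic_cubes_def)
      \<comment> \<open>The ancestors are nested as sets of points; what is disjoint are the
        one-element sets of cubes, because the levels differ.\<close>
      show "disjoint_family (\<lambda>k. {Q k})" by (auto simp: disjoint_family_on_def Q_def)
      fix k
      have "v \<le> measure lebesgue (E \<inter> Q k)"
        unfolding v_def using sub[of k] lm by (intro measure_mono_fmeasurable) (auto simp: Q_def fmeasurableD)
      then have "ennreal (K * v powr (\<rho> / p)) \<le> ennreal (K * measure lebesgue (E \<inter> Q k) powr (\<rho> / p))"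
        using K pos r \<open>0 < p\<close> by (intro ennreal_leI mult_left_mono powr_mono2) (auto simp: v_def)
      also have "\<dots> \<le> g (Q k)"
        using gK[of "- int k" "\<chi> l. m $ l div 2 ^ k"] \<open>p = t\<close>
        by (simp add: Q_def measure_dyadic_cube)
      finally show "ennreal (K * v powr (\<rho> / p)) \<le> sum g {Q k}" by simp
    qed auto
  next
    assume "r \<le> ennreal t"
    then have rt: "\<rho> \<le> t" using r \<open>0 < p\<close> \<open>p \<le> t\<close> by (simp add: ennreal_le_iff)
    let ?c = "K * (v / 2) powr (\<rho> / p)"
    show ?thesis
    proof (rule infsum_eq_top_if_levels[where L = "\<lambda>k. dyadic_cube (int k) ` subindices k m" and c = "?c * (v / 2)"])
      show "0 < ?c * (v / 2)" using K pos by (simp add: v_def)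
      show "finite (dyadic_cube (int k) ` subindices k m)" for k by (simp add: finite_subindices)
      show "dyadic_cube (int k) ` subindices k m \<subseteq> dyadic_cubes" for k by (auto simp: dyadic_cubes_def)
      show "disjoint_family (\<lambda>k. dyadic_cube (int k) ` subindices k m)" by (auto simp: disjoint_family_on_def)
      fix k
      define h where "h = 2 powr (- real k * CARD('n))"
      have h: "measure lebesgue (dyadic_cube (int k) m' :: (real ^ 'n) set) = h" "0 < h" "h \<le> 1" for m'
        by (auto simp: measure_dyadic_cube h_def powr_minus_divide ge_one_powr_ge_zero)
      define e where "e m' = measure lebesgue (E \<inter> dyadic_cube (int k) m')" for m'
      have sum_e: "(\<Sum>m'\<in>subindices k m. e m') = v"
        unfolding e_def v_def using measure_dyadic_cube_partition[OF E, of 0 k m] by simp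
      \<comment> \<open>Taking the whole space as the measured set expresses that the subcubes fill
        volume 1.\<close>
      have sum_h: "(\<Sum>m'\<in>subindices k m. h) = 1"
        using measure_dyadic_cube_partition[of "UNIV :: (real ^ 'n) set" 0 k m] h by simp
      \<comment> \<open>The bound is linear in the mass \<open>e m'\<close>, so it can be summed
        exactly over a generation. It is trivial for cubes of density at most v/2, half the average
        density, as its left side is then not positive.\<close>
      have key: "(v / 2) powr (\<rho> / p) * (e m' - v / 2 * h) \<le> h powr (\<rho> / t - \<rho> / p) * e m' powr (\<rho> / p)" for m'
      proof (cases "e m' \<le> v / 2 * h")
        case True
        then have "(v / 2) powr (\<rho> / p) * (e m' - v / 2 * h) \<le> 0" by (simp add: mult_nonneg_nonpos)
        also have "\<dots> \<le> h powr (\<rho> / t - \<rho> / p) * e m' powr (\<rho> / p)" by simp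
        finally show ?thesis .
      next
        case False
        have "e m' \<le> measure lebesgue (dyadic_cube (int k) m')"
          unfolding e_def using lm by (intro measure_mono_fmeasurable) (auto simp: fmeasurableD)
        then have eh: "e m' \<le> h" by (simp add: h)
        \<comment> \<open>Here \<open>\<rho> \<le> t\<close> enters: for h at most 1 the smaller
          exponent gives the larger power.\<close>
        have "h powr 1 \<le> h powr (\<rho> / t)"
          using h rt r by (intro powr_mono') auto
        have "0 \<le> v / 2 * h" using h pos by (simp add: v_def)
        then have "(v / 2) powr (\<rho> / p) * (e m' - v / 2 * h) \<le> (v / 2) powr (\<rho> / p) * h"
          using eh by (intro mult_left_mono) auto
        also have "\<dots> \<le> (v / 2) powr (\<rho> / p) * h powr (\<rho> / t)"
          using \<open>h powr 1 \<le> h powr (\<rho> / t)\<close> h by (intro mult_left_mono) auto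
        also have "\<dots> = h powr (\<rho> / t - \<rho> / p) * (v / 2 * h) powr (\<rho> / p)"
          using h(2) by (simp only: powr_mult powr_diff) simp
        also have "\<dots> \<le> h powr (\<rho> / t - \<rho> / p) * e m' powr (\<rho> / p)"
          using False h pos r \<open>0 < p\<close> by (intro mult_left_mono powr_mono2) (auto simp: v_def)
        finally show ?thesis .
      qed
      \<comment> \<open>The masses add up to v and the volumes to 1, which leaves v - v/2.\<close>
      have "?c * (v / 2) = (\<Sum>m'\<in>subindices k m. K * ((v / 2) powr (\<rho> / p) * (e m' - v / 2 * h)))"
        by (simp only: sum_distrib_left[symmetric] sum_subtractf sum_e sum_h) (simp add: algebra_simps)
      also have "\<dots> \<le> (\<Sum>m'\<in>subindices k m. K * (h powr (\<rho> / t - \<rho> / p) * e m' powr (\<rho> / p)))"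
        using key K by (intro sum_mono mult_left_mono) auto
      finally have "ennreal (?c * (v / 2)) \<le> ennreal (\<Sum>m'\<in>subindices k m. K * (h powr (\<rho> / t - \<rho> / p) * e m' powr (\<rho> / p)))"
        by (rule ennreal_leI)
      also have "\<dots> = (\<Sum>m'\<in>subindices k m. ennreal (K * (h powr (\<rho> / t - \<rho> / p) * e m' powr (\<rho> / p))))"
        using K by (intro sum_ennreal[symmetric]) auto
      also have "\<dots> \<le> (\<Sum>m'\<in>subindices k m. g (dyadic_cube (int k) m'))"
        using gK[of "int k"] by (intro sum_mono) (simp add: h e_def)
      also have "\<dots> = sum g (dyadic_cube (int k) ` subindices k m)"
        by (subst sum.reindex) (auto intro: inj_onI)
      finally show "ennreal (?c * (v / 2)) \<le> sum g (dyadic_cube (int k) ` subindices k m)" .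
    qed
  qed
  moreover have "bml_norm p q t r f = epowr (infsum g dyadic_cubes) (1 / \<rho>)"
    using \<open>r < \<infinity>\<close> by (auto simp: bml_norm_def g_def[abs_def] \<rho>_def)
  ultimately show ?thesis by (simp add: epowr_def)
qed

section \<open>Inside the range, the indicator of the unit cube has finite quasi-norm\<close>

subsection \<open>The quasi-norm of the unit cube\<close>

lemma lorentz_norm_on_indicator:
  "lorentz_norm_on p q Q (indicator A) = lorentz_norm p q (indicator (A \<inter> Q))"
proof -
  have "(\<lambda>x. indicator A x * indicator Q x :: complex) = indicator (A \<inter> Q)"
    by (auto simp: indicator_def)
  then show ?thesis by (simp add: lorentz_norm_on_def)
qed

text \<open>The zero function is the indicator of the empty set, so the upper Lorentz bound applies
  to it.\<close>

lemma bml_norm_zero: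
  assumes "0 < p" "0 < q"
  shows "bml_norm p q t r (\<lambda>x :: real ^ 'n. 0) = 0"
proof -
  obtain C where "\<And>A :: (real ^ 'n) set. A \<in> lmeasurable \<Longrightarrow>
    lorentz_norm p q (indicator A) \<le> ennreal (C * measure lebesgue A powr (1 / p))"
    using lorentz_indicator_le[OF assms] by metis
  from this[of "{}"] have "lorentz_norm p q (indicator {} :: real ^ 'n \<Rightarrow> complex) = 0" by simp
  moreover have "(indicator {} :: real ^ 'n \<Rightarrow> complex) = (\<lambda>x. 0)" by auto
  ultimately have "lorentz_norm_on p q Q (\<lambda>x :: real ^ 'n. 0) = 0" for Q
    by (simp add: lorentz_norm_on_def)
  moreover have "(SUP Q\<in>dyadic_cubes :: (real ^ 'n) set set. 0 :: ennreal) = 0"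
    using SUP_bot by (metis bot_ennreal)
  ultimately show ?thesis by (simp add: bml_norm_def epowr_def)
qed

text \<open>Cubes are split by volume. If |Q| is at most 1, bounding the intersection by |Q| leaves
  |Q|^(1/t). If |Q| exceeds 1, the intersection has measure at most 1 and the exponent 1/t - 1/p is
  not positive.\<close>

lemma bml_norm_unit_cube_infinite:
  assumes "0 < p" "0 < q" "p \<le> t"
  shows "bml_norm p q t \<infinity> (indicator (dyadic_cube 0 (0 :: int ^ 'n)) :: real ^ 'n \<Rightarrow> complex) < \<infinity>"
proof -
  let ?I = "dyadic_cube 0 (0 :: int ^ 'n)"
  obtain C where C: "0 \<le> C" "\<And>A :: (real ^ 'n) set. A \<in> lmeasurable \<Longrightarrow>
    lorentz_norm p q (indicator A) \<le> ennreal (C * measure lebesgue A powr (1 / p))"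
    using lorentz_indicator_le[OF assms(1,2)] by metis
  have "ennreal (measure lebesgue Q powr (1 / t - 1 / p)) * lorentz_norm_on p q Q (indicator ?I) \<le> ennreal C"
    if Q_dyadic: "Q \<in> dyadic_cubes" for Q
  proof -
    obtain j m where Q: "Q = dyadic_cube j m" using Q_dyadic by (auto simp: dyadic_cubes_def)
    let ?h = "measure lebesgue Q" and ?e = "measure lebesgue (?I \<inter> Q)"
    have h: "0 < ?h" by (simp add: Q measure_dyadic_cube)
    have lm: "?I \<inter> Q \<in> lmeasurable" by (simp add: Q fmeasurable.Int)
    have e: "?e \<le> 1" "?e \<le> ?h"
      using measure_mono_fmeasurable[of "?I \<inter> Q" ?I lebesgue] measure_mono_fmeasurable[of "?I \<inter> Q" Q lebesgue] lm
      by (auto simp: Q fmeasurableD)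
    have "?h powr (1 / t - 1 / p) * ?e powr (1 / p) \<le> 1"
    proof (cases "?h \<le> 1")
      case True
      have "?h powr (1 / t - 1 / p) * ?e powr (1 / p) \<le> ?h powr (1 / t - 1 / p) * ?h powr (1 / p)"
        using e assms by (intro mult_left_mono powr_mono2) auto
      also have "\<dots> = ?h powr (1 / t)" by (simp flip: powr_add)
      also have "\<dots> \<le> 1" using True assms by (intro powr_le1) auto
      finally show ?thesis .
    next
      case False
      have "?h powr (1 / t - 1 / p) \<le> ?h powr 0"
        using False assms by (intro powr_mono) (auto simp: field_simps)
      moreover have "?e powr (1 / p) \<le> 1" using e assms by (intro powr_le1) auto
      ultimately show ?thesis using h by (simp add: mult_le_one)
    qed
    then have "C * (?h powr (1 / t - 1 / p) * ?e powr (1 / p)) \<le> C * 1" using C by (intro mult_left_mono)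
    then have "ennreal (?h powr (1 / t - 1 / p)) * ennreal (C * ?e powr (1 / p)) \<le> ennreal C"
      using C by (simp add: ennreal_leI mult_ac flip: ennreal_mult)
    moreover have "ennreal (?h powr (1 / t - 1 / p)) * lorentz_norm_on p q Q (indicator ?I)
       \<le> ennreal (?h powr (1 / t - 1 / p)) * ennreal (C * ?e powr (1 / p))"
      unfolding lorentz_norm_on_indicator by (intro mult_left_mono C(2) lm) auto
    ultimately show ?thesis by (rule order_trans[rotated])
  qed
  then have "bml_norm p q t \<infinity> (indicator ?I :: real ^ 'n \<Rightarrow> complex) \<le> ennreal C"
    by (auto simp: bml_norm_def intro!: SUP_least)
  then show ?thesis by (simp add: le_less_trans less_top)
qed

text \<open>Only descendants and ancestors of the unit cube contribute. Generation k of the former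
  sums to a^k, the ancestor of side 2^k gives b^k, and the bound does not depend on F.\<close>

lemma sum_dyadic_cubes_le:
  fixes F :: "(real ^ 'n) set set"
  assumes p: "0 < p" "p < t" "t < \<rho>" and F: "finite F" "F \<subseteq> dyadic_cubes"
  defines "a \<equiv> 2 powr (- (real CARD('n) * (\<rho> / t - 1)))" and "b \<equiv> 2 powr (real CARD('n) * (\<rho> / t - \<rho> / p))"
  shows "(\<Sum>Q\<in>F. measure lebesgue Q powr (\<rho> / t - \<rho> / p) *
      measure lebesgue (dyadic_cube 0 0 \<inter> Q) powr (\<rho> / p)) \<le> 1 / (1 - a) + 1 / (1 - b)"
proof -
  let ?I = "dyadic_cube 0 0 :: (real ^ 'n) set"
  define G where "G Q = measure lebesgue Q powr (\<rho> / t - \<rho> / p) * measure lebesgue (?I \<inter> Q) powr (\<rho> / p)" for Q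
  define U where "U k = dyadic_cube (int k) ` (subindices k 0 :: (int ^ 'n) set)" for k
  \<comment> \<open>All ancestors of the unit cube at the origin have index 0, because
    \<open>0 div 2 ^ k = 0\<close>.\<close>
  define V where "V k = dyadic_cube (- int k) (0 :: int ^ 'n)" for k
  \<comment> \<open>The ratio a is below 1 because \<open>t < \<rho>\<close>, and b because
    \<open>p < t\<close>.\<close>
  have ab: "0 \<le> a" "a < 1" "0 \<le> b" "b < 1"
    using p powr_less_mono[of "- (real CARD('n) * (\<rho> / t - 1))" 0 2]
      powr_less_mono[of "real CARD('n) * (\<rho> / t - \<rho> / p)" 0 2]
    by (auto simp: a_def b_def mult_less_0_iff divide_strict_left_mono)
  have G0: "0 \<le> G Q" for Q by (simp add: G_def)
  \<comment> \<open>A nonzero term forces Q to meet the unit cube. The common point makes Q a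
    descendant or an ancestor according to the sign of its level.\<close>
  have sub: "\<exists>k. Q \<in> insert (V k) (U k)" if "Q \<in> F" and GQ: "G Q \<noteq> 0" for Q
  proof -
    have "Q \<in> dyadic_cubes" using \<open>Q \<in> F\<close> F by blast
    then obtain j m where Q: "Q = dyadic_cube j m" by (auto simp: dyadic_cubes_def)
    have "?I \<inter> Q \<noteq> {}" using GQ by (auto simp: G_def)
    then obtain x where x: "x \<in> ?I" "x \<in> Q" by blast
    show ?thesis
    proof (cases "j \<ge> 0")
      case True
      then obtain k where k: "j = int k" by (metis nonneg_int_cases)
      have "x \<in> dyadic_cube 0 (\<chi> l. m $ l div 2 ^ k)"
        using x Q k by (intro dyadic_cube_parent) auto
      with x dyadic_cube_eq_if_meet have "(\<chi> l. m $ l div 2 ^ k) = 0" by blast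
      then have "m \<in> subindices k 0" by (simp add: subindices_def vec_eq_iff)
      then show ?thesis using Q k by (auto simp: U_def)
    next
      case False
      then obtain k where k: "j = - int k" by (metis linear nonpos_int_cases)
      have "x \<in> V k" using dyadic_cube_parent[of x "- int k" k 0] x
        by (simp add: V_def flip: zero_vec_def)
      with x dyadic_cube_eq_if_meet have "m = 0" by (auto simp: Q k V_def)
      then show ?thesis using Q k by (auto simp: V_def)
    qed
  qed
  then obtain lev where lev: "\<And>Q. Q \<in> F \<Longrightarrow> G Q \<noteq> 0 \<Longrightarrow> Q \<in> insert (V (lev Q)) (U (lev Q))" by metis
  \<comment> \<open>A bound for all levels that occur; inserting 0 keeps \<open>Max\<close>
    meaningful when F is empty.\<close>
  define N where "N = Suc (Max (insert 0 (lev ` F)))"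
  have lN: "lev Q < N" if "Q \<in> F" for Q using F that by (auto simp: N_def less_Suc_eq_le)
  have finU: "finite (U k)" for k by (simp add: U_def finite_subindices)
  have GU: "sum G (U k) = a ^ k" for k
  proof -
    define h where "h = 2 powr (- real k * CARD('n))"
    have h: "measure lebesgue (dyadic_cube (int k) m' :: (real ^ 'n) set) = h" "0 < h" for m'
      by (auto simp: measure_dyadic_cube h_def)
    \<comment> \<open>The number of subcubes is read off from their common volume h.\<close>
    have "(\<Sum>m'\<in>subindices k (0 :: int ^ 'n). h) = 1"
      using measure_dyadic_cube_partition[of "UNIV :: (real ^ 'n) set" 0 k 0] h by simp
    then have card: "real (card (subindices k (0 :: int ^ 'n))) = 1 / h" using h by (simp add: field_simps)
    have "sum G (U k) = (\<Sum>m'\<in>subindices k 0. G (dyadic_cube (int k) m'))"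
      unfolding U_def by (subst sum.reindex) (auto intro: inj_onI)
    also have "\<dots> = (\<Sum>m'\<in>subindices k (0 :: int ^ 'n). h powr (\<rho> / t))"
    proof (rule sum.cong[OF refl])
      fix m' :: "int ^ 'n" assume "m' \<in> subindices k 0"
      then have "dyadic_cube (int k) m' \<subseteq> ?I" using dyadic_cube_partition[of 0 0 k] by auto
      then have "?I \<inter> dyadic_cube (int k) m' = dyadic_cube (int k) m'" by blast
      then show "G (dyadic_cube (int k) m') = h powr (\<rho> / t)" by (simp add: G_def h flip: powr_add)
    qed
    also have "\<dots> = h powr (\<rho> / t - 1)" using h by (simp add: card powr_diff)
    also have "\<dots> = a ^ k"
      by (simp add: h_def a_def powr_powr algebra_simps flip: powr_realpow)
    finally show ?thesis .
  qed
  have GV: "G (V k) = b ^ k" for k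
  proof -
    have "?I \<subseteq> V k"
      using dyadic_cube_parent[of _ "- int k" k 0] by (auto simp: V_def simp flip: zero_vec_def)
    then have "?I \<inter> V k = ?I" by blast
    then have "G (V k) = (2 powr (real k * CARD('n))) powr (\<rho> / t - \<rho> / p)"
      by (simp add: G_def V_def measure_dyadic_cube)
    also have "\<dots> = b ^ k"
      by (simp add: b_def powr_powr algebra_simps flip: powr_realpow)
    finally show ?thesis .
  qed
  have geo: "(\<Sum>k<N. c ^ k) \<le> 1 / (1 - c)" if "0 \<le> c" "c < 1" for c :: real
    using sum_le_suminf[of "\<lambda>k. c ^ k" "{..<N}"] suminf_geometric[of c] that by simp
  have "sum G F = sum G {Q \<in> F. G Q \<noteq> 0}"
    using F by (intro sum.mono_neutral_right) auto
  also have "\<dots> \<le> sum G (\<Union>k<N. insert (V k) (U k))"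
    using lev lN G0 finU by (intro sum_mono2) blast+
  also have "\<dots> = (\<Sum>k<N. sum G (insert (V k) (U k)))"
    using finU by (intro sum.UNION_disjoint) (auto simp: U_def V_def)
  also have "\<dots> \<le> (\<Sum>k<N. a ^ k + b ^ k)"
  proof (rule sum_mono)
    fix k
    \<comment> \<open>For k = 0 the unit cube belongs to both families, hence only an
      inequality.\<close>
    have "sum G (insert (V k) (U k)) \<le> sum G (U k) + G (V k)"
      using finU[of k] G0[of "V k"] by (cases "V k \<in> U k") (auto simp: insert_absorb)
    then show "sum G (insert (V k) (U k)) \<le> a ^ k + b ^ k" by (simp add: GU GV)
  qed
  also have "\<dots> \<le> 1 / (1 - a) + 1 / (1 - b)"
    using geo ab by (simp add: sum.distrib add_mono)
  finally show ?thesis by (simp add: G_def)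
qed

text \<open>An infinite sum in \<open>ennreal\<close> is the supremum of its finite partial sums,
  and these have a common bound by \<open>sum_dyadic_cubes_le\<close>.\<close>

lemma bml_norm_unit_cube_finite:
  assumes "0 < p" "0 < q" "p < t" "ennreal t < r" "r < \<infinity>"
  shows "bml_norm p q t r (indicator (dyadic_cube 0 (0 :: int ^ 'n)) :: real ^ 'n \<Rightarrow> complex) < \<infinity>"
proof -
  let ?I = "dyadic_cube 0 (0 :: int ^ 'n)"
  define \<rho> where "\<rho> = enn2real r"
  have r: "t < \<rho>" "0 < \<rho>"
    using assms unfolding \<rho>_def by (cases r; simp add: ennreal_less_iff)+
  obtain C where C: "0 \<le> C" "\<And>A :: (real ^ 'n) set. A \<in> lmeasurable \<Longrightarrow>
    lorentz_norm p q (indicator A) \<le> ennreal (C * measure lebesgue A powr (1 / p))"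
    using lorentz_indicator_le[OF assms(1,2)] by metis
  define g where "g Q = ennreal (measure lebesgue Q powr (\<rho> / t - \<rho> / p)) *
       epowr (lorentz_norm_on p q Q (indicator ?I)) \<rho>" for Q
  define G where "G Q = measure lebesgue Q powr (\<rho> / t - \<rho> / p) * measure lebesgue (?I \<inter> Q) powr (\<rho> / p)" for Q
  have gG: "g Q \<le> ennreal (C powr \<rho> * G Q)" if Q_dyadic: "Q \<in> dyadic_cubes" for Q
  proof -
    obtain j m where Q: "Q = dyadic_cube j m" using Q_dyadic by (auto simp: dyadic_cubes_def)
    have lm: "?I \<inter> Q \<in> lmeasurable" by (simp add: Q fmeasurable.Int)
    have "g Q \<le> ennreal (measure lebesgue Q powr (\<rho> / t - \<rho> / p)) *
       epowr (ennreal (C * measure lebesgue (?I \<inter> Q) powr (1 / p))) \<rho>"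
      unfolding g_def lorentz_norm_on_indicator using r
      by (intro mult_left_mono epowr_mono C(2) lm) auto
    also have "\<dots> = ennreal (C powr \<rho> * G Q)"
      using C by (simp add: G_def epowr_ennreal powr_mult powr_powr mult_ac flip: ennreal_mult)
    finally show ?thesis .
  qed
  define B where "B = 1 / (1 - 2 powr (- (real CARD('n) * (\<rho> / t - 1)))) + 1 / (1 - 2 powr (real CARD('n) * (\<rho> / t - \<rho> / p)))"
  have "infsum g dyadic_cubes = (SUP F\<in>{F. finite F \<and> F \<subseteq> dyadic_cubes}. sum g F)"
    by (rule nonneg_infsum_complete) simp
  also have "\<dots> \<le> ennreal (C powr \<rho> * B)"
  proof (rule SUP_least)
    fix F :: "(real ^ 'n) set set" assume F: "F \<in> {F. finite F \<and> F \<subseteq> dyadic_cubes}"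
    then have "sum g F \<le> (\<Sum>Q\<in>F. ennreal (C powr \<rho> * G Q))" by (intro sum_mono gG) auto
    also have "\<dots> = ennreal (C powr \<rho> * sum G F)"
      by (subst sum_ennreal) (auto simp: G_def sum_distrib_left)
    also have "\<dots> \<le> ennreal (C powr \<rho> * B)"
      using sum_dyadic_cubes_le[OF \<open>0 < p\<close> \<open>p < t\<close> r(1), of F] F
      by (intro ennreal_leI mult_left_mono) (auto simp: G_def B_def)
    finally show "sum g F \<le> ennreal (C powr \<rho> * B)" .
  qed
  finally have "infsum g dyadic_cubes < \<infinity>" by (simp add: le_less_trans less_top)
  moreover have "bml_norm p q t r (indicator ?I) = epowr (infsum g dyadic_cubes) (1 / \<rho>)"
    using \<open>r < \<infinity>\<close> by (auto simp: bml_norm_def g_def[abs_def] \<rho>_def)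
  ultimately show ?thesis by simp
qed

section \<open>Passage from functions to classes, and the equivalence\<close>

subsection \<open>Nontriviality\<close>

lemma ae_eq_class_eq_ae_zero_iff:
  assumes "f \<in> borel_measurable lebesgue"
  shows "ae_eq `` {f} = ae_zero \<longleftrightarrow> (AE x in lebesgue. f x = 0)"
proof
  assume "ae_eq `` {f} = ae_zero"
  moreover have "f \<in> ae_eq `` {f}" using assms by (simp add: ae_eq_def)
  ultimately have "f \<in> ae_zero" by simp
  then have "AE x in lebesgue. 0 = f x" by (simp add: ae_zero_def ae_eq_def)
  then show "AE x in lebesgue. f x = 0" by (rule eventually_mono) simp
next
  assume nz: "AE x in lebesgue. f x = 0"
  have "(AE x in lebesgue. f x = g x) \<longleftrightarrow> (AE x in lebesgue. 0 = g x)" for g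
    using nz by (intro eventually_cong) (auto elim: eventually_mono)
  then show "ae_eq `` {f} = ae_zero" using assms by (auto simp: ae_zero_def ae_eq_def)
qed

lemma image_eq_singleton_iff: "A \<noteq> {} \<Longrightarrow> f ` A = {c} \<longleftrightarrow> (\<forall>x\<in>A. f x = c)"
  using subset_singleton_iff[of "f ` A" c] by (simp add: image_subset_iff)

text \<open>The space is the image of the functions of finite quasi-norm under the class map. The
  zero function is among them, so this image is not empty, and it equals \<open>{ae_zero}\<close>
  exactly when the map is constant with that value.\<close>

lemma bml_space_eq_ae_zero_iff:
  assumes "0 < p" "0 < q"
  shows "(bml_space p q t r :: (real ^ 'n \<Rightarrow> complex) set set) = {ae_zero} \<longleftrightarrow>
    (\<forall>f :: real ^ 'n \<Rightarrow> complex. f \<in> borel_measurable lebesgue \<longrightarrow> bml_norm p q t r f < \<infinity> \<longrightarrow>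
      (AE x in lebesgue. f x = 0))"
proof -
  define W where "W = {f :: real ^ 'n \<Rightarrow> complex. f \<in> borel_measurable lebesgue \<and> bml_norm p q t r f < \<infinity>}"
  have "(\<lambda>x. 0) \<in> W" by (simp add: W_def bml_norm_zero[OF assms])
  then have "W \<noteq> {}" by blast
  moreover have "bml_space p q t r = (\<lambda>f. ae_eq `` {f}) ` W"
    by (auto simp: bml_space_def W_def quotient_def)
  ultimately have "(bml_space p q t r :: (real ^ 'n \<Rightarrow> complex) set set) = {ae_zero} \<longleftrightarrow> (\<forall>f\<in>W. ae_eq `` {f} = ae_zero)"
    by (simp add: image_eq_singleton_iff)
  also have "\<dots> \<longleftrightarrow> (\<forall>f\<in>W. AE x in lebesgue. f x = 0)"
    by (intro ball_cong refl ae_eq_class_eq_ae_zero_iff) (simp add: W_def)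
  finally show ?thesis by (auto simp: W_def)
qed

lemma not_AE_indicator_unit_cube:
  "\<not> (AE x in lebesgue. indicator (dyadic_cube 0 (0 :: int ^ 'n)) x = (0 :: complex))"
proof
  let ?I = "dyadic_cube 0 (0 :: int ^ 'n)"
  assume "AE x in lebesgue. indicator ?I x = (0 :: complex)"
  then have "AE x in lebesgue. x \<notin> ?I" by (auto simp: indicator_def elim: eventually_mono split: if_splits)
  then have "?I \<in> null_sets lebesgue"
    using AE_iff_null_sets[of ?I lebesgue] by (simp add: fmeasurableD)
  from measure_eq_0_null_sets[OF this] show False by simp
qed

theorem theorem2p19:
  fixes p t :: real and q r :: ennreal
  assumes "0 < q" and "0 < p" and "p \<le> t" and "0 < r"
  shows "(bml_space p q t r :: (real ^ 'n \<Rightarrow> complex) set set) \<noteq> {ae_zero} \<longleftrightarrow>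
    (0 < p \<and> p < t \<and> ennreal t < r \<and> r < \<infinity>) \<or> (0 < p \<and> p \<le> t \<and> r = \<infinity>)"
    (is "?nontrivial \<longleftrightarrow> ?range")
proof
  assume ?nontrivial
  then obtain f :: "real ^ 'n \<Rightarrow> complex" where f: "f \<in> borel_measurable lebesgue"
    "bml_norm p q t r f < \<infinity>" "\<not> (AE x in lebesgue. f x = 0)"
    using bml_space_eq_ae_zero_iff[OF \<open>0 < p\<close> \<open>0 < q\<close>] by blast
  show ?range
  proof (rule ccontr)
    assume "\<not> ?range"
    \<comment> \<open>Given 0 < p and p at most t, the complement of the range is exactly the
      situation of \<open>bml_norm_eq_top\<close>.\<close>
    then have "r < \<infinity>" "p = t \<or> r \<le> ennreal t" using assms by (auto simp: less_top not_less)
    with bml_norm_eq_top[of p q t r f] f assms show False by simp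
  qed
next
  assume ?range
  \<comment> \<open>The same function is a nonzero element in both parts of the range.\<close>
  then have "bml_norm p q t r (indicator (dyadic_cube 0 (0 :: int ^ 'n)) :: real ^ 'n \<Rightarrow> complex) < \<infinity>"
    using bml_norm_unit_cube_finite bml_norm_unit_cube_infinite assms by metis
  moreover have "(indicator (dyadic_cube 0 (0 :: int ^ 'n)) :: real ^ 'n \<Rightarrow> complex) \<in> borel_measurable lebesgue"
    by (intro borel_measurable_indicator fmeasurableD) simp
  ultimately show ?nontrivial
    using bml_space_eq_ae_zero_iff[OF \<open>0 < p\<close> \<open>0 < q\<close>] not_AE_indicator_unit_cube by blast
qed

end
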